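(* Let $0\le q\le 1/2$ and let $(T_n)_{n\ge1}$ be the BCMRT$(q)$ process. For $k\ge2$ let $X_k$ be the indicator of the event that the two nodes $(k,A)$ and $(k,B)$ attach to the same node, let $Z_n=\sum_{k=2}^nX_k$, and for $n\ge2$ let $$\hat q_n=\varphi\left(\frac{Z_n}{2\log n}\right),\qquad \varphi(x)=\frac12\left(1-\sqrt{(1-4x)_+}\right)\quad (x\ge0).$$ Then $\hat q_n\to q$ in probability as $n\to\infty$. Moreover: - if $q=0$, then $\hat q_n$ is a Dirac mass at $0$ (i.e. $\hat q_n=0$ almost surely); - if $q\in(0,1/2)$, then $$\left(\frac{2\log n}{q(1-q)}\right)^{1/2}(\hat q_n-q)\ \longrightarrow\ \frac{1}{1-2q}\,\mathcal N(0,1)\quad\text{in distribution as }n\to\infty;$$ - if $q=1/2$, then $$\left(\frac{\log n}{2}\right)^{1/4}\left(\hat q_n-\frac12\right)\ \longrightarrow\ -\frac12\sqrt{(\mathcal N(0,1))_+}\quad\text{in distribution as }n\to\infty.$$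
   Context: BCMRT$(q)$ (balanced community modulated random recursive tree), $q\in[0,1]$: $T_1$ is a single edge (the root edge) joining two nodes with time-label $1$, one of type $A$, denoted $(1,A)$, and one of type $B$, denoted $(1,B)$. At each step $n\ge 2$, two new nodes with time-label $n$, namely $(n,A)$ of type $A$ and $(n,B)$ of type $B$, are added to the tree $T_{n-1}$ of size $2(n-1)$: (1) the two nodes independently (of each other and of the past) decide to connect to a node of their own type with probability $1-q$, or to a node of the other type with probability $q$; (2) each then independently chooses its parent uniformly among the $n-1$ nodes of $T_{n-1}$ of the selected type and is joined to it by an edge. This yields the tree $T_n$ of size $2n$. Notation: $(u)_+=\max(u,0)$; $\mathcal N(0,1)$ denotes a standard Gaussian random variable. *)

theory Defs
  imports "HOL-Probability.Probability"
begin

datatype community = TypeA | TypeB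

fun other_type :: "community \<Rightarrow> community" where
  "other_type TypeA = TypeB"
| "other_type TypeB = TypeA"

type_synonym node = "nat \<times> community"

(* Undirected edges are two-element sets of nodes. *)
record node_tree =
  nodes :: "node set"
  edges :: "node set set"

definition root_tree :: node_tree where
  "root_tree = \<lparr>nodes = {(1, TypeA), (1, TypeB)}, edges = {{(1, TypeA), (1, TypeB)}}\<rparr>"

definition nodes_of_type :: "node_tree \<Rightarrow> community \<Rightarrow> node set" where
  "nodes_of_type t c = {v \<in> nodes t. snd v = c}"

definition attach :: "nat \<Rightarrow> node \<Rightarrow> node \<Rightarrow> node_tree \<Rightarrow> node_tree" where
  "attach n u v t =
     \<lparr>nodes = nodes t \<union> {(n, TypeA), (n, TypeB)},
      edges = edges t \<union> {{(n, TypeA), u}, {(n, TypeB), v}}\<rparr>"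

definition parent_type_pmf :: "real \<Rightarrow> community \<Rightarrow> community pmf" where
  "parent_type_pmf q c = map_pmf (\<lambda>switch. if switch then other_type c else c) (bernoulli_pmf q)"

(* The law of T_n given T_(n-1) = t.  No distribution below depends on an earlier draw of the
   other new node, so the choices of the two new nodes are independent. *)
definition bcmrt_step :: "real \<Rightarrow> nat \<Rightarrow> node_tree \<Rightarrow> node_tree pmf" where
  "bcmrt_step q n t = do {
     c \<leftarrow> parent_type_pmf q TypeA;
     d \<leftarrow> parent_type_pmf q TypeB;
     u \<leftarrow> pmf_of_set (nodes_of_type t c);
     v \<leftarrow> pmf_of_set (nodes_of_type t d);
     return_pmf (attach n u v t)
   }"

(* The transition assumption is the Markov property with kernel bcmrt_step, multiplied out so that
   it does not condition on null events: the new choices are independent of the whole past.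
   T 0 carries no meaning. *)
locale bcmrt = prob_space M for M :: "'w measure" +
  fixes q :: real and T :: "nat \<Rightarrow> 'w \<Rightarrow> node_tree"
  assumes q_range: "0 \<le> q" "q \<le> 1"
    and measurable_tree: "\<And>n. n \<ge> 1 \<Longrightarrow> T n \<in> measurable M (count_space UNIV)"
    and initial: "AE \<omega> in M. T 1 \<omega> = root_tree"
    and transition: "\<And>n t. n \<ge> 2 \<Longrightarrow>
      prob {\<omega> \<in> space M. \<forall>k\<in>{1..n}. T k \<omega> = t k} =
      prob {\<omega> \<in> space M. \<forall>k\<in>{1..n-1}. T k \<omega> = t k} * pmf (bcmrt_step q n (t (n-1))) (t n)"

(* Restricting v to the nodes of T_(k-1) makes v the parent of both new nodes. *)
definition X :: "(nat \<Rightarrow> 'w \<Rightarrow> node_tree) \<Rightarrow> nat \<Rightarrow> 'w \<Rightarrow> real" where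
  "X T k \<omega> = of_bool (\<exists>v \<in> nodes (T (k-1) \<omega>).
     {(k, TypeA), v} \<in> edges (T k \<omega>) \<and> {(k, TypeB), v} \<in> edges (T k \<omega>))"

definition Z :: "(nat \<Rightarrow> 'w \<Rightarrow> node_tree) \<Rightarrow> nat \<Rightarrow> 'w \<Rightarrow> real" where
  "Z T n \<omega> = (\<Sum>k=2..n. X T k \<omega>)"

definition phi :: "real \<Rightarrow> real" where
  "phi x = (1 - sqrt (max (1 - 4 * x) 0)) / 2"

definition q_hat :: "(nat \<Rightarrow> 'w \<Rightarrow> node_tree) \<Rightarrow> nat \<Rightarrow> 'w \<Rightarrow> real" where
  "q_hat T n \<omega> = phi (Z T n \<omega> / (2 * ln (real n)))"

definition tendsto_in_prob :: "'w measure \<Rightarrow> (nat \<Rightarrow> 'w \<Rightarrow> real) \<Rightarrow> real \<Rightarrow> bool" where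
  "tendsto_in_prob M Y c \<longleftrightarrow>
     (\<forall>\<epsilon>>0. (\<lambda>n. measure M {\<omega> \<in> space M. \<bar>Y n \<omega> - c\<bar> > \<epsilon>}) \<longlonglongrightarrow> 0)"

end

theory Submission
  imports Defs "HOL-Real_Asymp.Real_Asymp"
begin

text \<open>
  Whatever the tree, step \<open>k\<close> attaches both new nodes to one parent with probability
  \<open>2 q (1 - q) / (k - 1)\<close>: exactly one of them has to switch type, and then the two uniform choices
  have to agree. Hence \<open>Z\<close> is a sum of independent Bernoulli variables with mean
  \<open>2 q (1 - q) log n + O(1)\<close>, close to a Poisson variable, and comparing characteristic functions
  gives a central limit theorem. The map \<open>phi\<close> inverts \<open>q \<mapsto> q (1 - q)\<close> on \<open>[0, 1/2]\<close>. It is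
  differentiable at \<open>q (1 - q)\<close> for \<open>q < 1/2\<close>, which yields the Gaussian limit, while the square-root
  singularity at \<open>1/4\<close> produces the limit for \<open>q = 1/2\<close>. Both are instances of a continuous mapping
  theorem for sequences of maps, obtained from Skorohod's coupling.
\<close>

subsection \<open>The law of the number of siblings\<close>

lemma (in prob_space) prob_eq_pmf:
  fixes W :: "'a \<Rightarrow> 'b" and p :: "'b pmf"
  assumes meas: "\<And>x. x \<in> set_pmf p \<Longrightarrow> {\<omega> \<in> space M. W \<omega> = x} \<in> events"
    and eq: "\<And>x. x \<in> set_pmf p \<Longrightarrow> prob {\<omega> \<in> space M. W \<omega> = x} = pmf p x"
    and A: "{\<omega> \<in> space M. W \<omega> \<in> A} \<in> events"
  shows "prob {\<omega> \<in> space M. W \<omega> \<in> A} = measure_pmf.prob p A"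
proof -
  \<comment> \<open>The values of \<open>W\<close> outside the support of \<open>p\<close> need not form an event, so only a lower bound
    is immediate. Equality follows since the bounds for \<open>A\<close> and its complement add up to 1.\<close>
  have lower: "measure_pmf.prob p B \<le> prob {\<omega> \<in> space M. W \<omega> \<in> B}"
    if B: "{\<omega> \<in> space M. W \<omega> \<in> B} \<in> events" for B
  proof -
    let ?I = "B \<inter> set_pmf p"
    have "emeasure p B = (\<integral>\<^sup>+ x. pmf p x \<partial>count_space ?I)"
      by (simp add: nn_integral_pmf emeasure_Int_set_pmf)
    also have "\<dots> = (\<integral>\<^sup>+ x. emeasure M {\<omega> \<in> space M. W \<omega> = x} \<partial>count_space ?I)"
      by (intro nn_integral_cong) (auto simp: emeasure_eq_measure eq)
    also have "\<dots> = emeasure M (\<Union>x\<in>?I. {\<omega> \<in> space M. W \<omega> = x})"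
      by (intro emeasure_UN_countable[symmetric])
        (auto simp: disjoint_family_on_def intro!: meas countable_Int2)
    also have "\<dots> \<le> emeasure M {\<omega> \<in> space M. W \<omega> \<in> B}"
      using B by (intro emeasure_mono) auto
    finally show ?thesis
      by (simp add: emeasure_eq_measure measure_pmf.emeasure_eq_measure)
  qed
  have compl: "{\<omega> \<in> space M. W \<omega> \<in> - A} = space M - {\<omega> \<in> space M. W \<omega> \<in> A}"
    by auto
  have "measure_pmf.prob p (- A) \<le> prob {\<omega> \<in> space M. W \<omega> \<in> - A}"
    using A compl by (intro lower) auto
  moreover have "prob {\<omega> \<in> space M. W \<omega> \<in> - A} = 1 - prob {\<omega> \<in> space M. W \<omega> \<in> A}"
    unfolding compl using A by (rule prob_compl)
  moreover have "measure_pmf.prob p (- A) = 1 - measure_pmf.prob p A"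
    using measure_pmf.prob_compl[of A p] by (simp add: Compl_eq_Diff_UNIV)
  ultimately show ?thesis using lower[OF A] by linarith
qed

lemma bool_pmf_eqI:
  fixes p p' :: "bool pmf"
  assumes "pmf p True = pmf p' True"
  shows "p = p'"
proof (rule pmf_eqI)
  have "pmf r False = 1 - pmf r True" for r :: "bool pmf"
    using sum_pmf_eq_1[of "{False, True}" r] by (auto simp: subset_iff)
  then show "pmf p b = pmf p' b" for b
    using assms by (cases b) auto
qed

lemma pmf_bernoulli_eqI:
  assumes "0 \<le> r" "r \<le> 1" "pmf p True = r"
  shows "p = bernoulli_pmf r"
  using assms by (intro bool_pmf_eqI) simp

text \<open>Given \<open>u\<close>, the second draw hits it with probability
  \<open>1 / card B\<close> if \<open>u\<close> lies in \<open>B\<close> and never otherwise;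
  averaging over \<open>u\<close> counts the common elements.\<close>

lemma coincidence_pmf_of_set:
  assumes "finite A" "A \<noteq> {}" "finite B" "B \<noteq> {}"
  shows "pmf (bind_pmf (pmf_of_set A) (\<lambda>u. map_pmf (\<lambda>v. u = v) (pmf_of_set B))) True =
    card (A \<inter> B) / (card A * card B)"
proof -
  have "pmf (map_pmf (\<lambda>v. u = v) (pmf_of_set B)) True = indicator B u / card B" for u
  proof -
    have "(\<lambda>v. u = v) -` {True} = {u}" by auto
    then show ?thesis using assms by (simp add: pmf_map measure_pmf_single)
  qed
  then have "pmf (bind_pmf (pmf_of_set A) (\<lambda>u. map_pmf (\<lambda>v. u = v) (pmf_of_set B))) True =
      (\<Sum>u\<in>A. indicator B u / card B) / card A"
    unfolding pmf_bind integral_pmf_of_set[OF assms(2,1)] by simp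
  also have "(\<Sum>u\<in>A. indicator B u / real (card B)) = card (A \<inter> B) / card B"
    using assms by (simp add: sum_divide_distrib[symmetric] indicator_def sum.If_cases Int_def)
  finally show ?thesis by (simp add: ac_simps)
qed

section \<open>One step of the tree process\<close>

text \<open>The invariant of trees reached with positive probability. The edge condition guarantees
  that no edge touches a label larger than \<open>n\<close>, so edges at the next two nodes can only
  come from the next step.\<close>

definition grown :: "nat \<Rightarrow> node_tree \<Rightarrow> bool" where
  "grown n t \<longleftrightarrow> nodes t = {1..n} \<times> UNIV \<and> edges t \<subseteq> Pow (nodes t)"

text \<open>The event behind \<open>X\<close>, written as a relation between consecutive trees so
  that it can be pushed forward through the kernel \<open>bcmrt_step\<close>.\<close>

definition siblings :: "nat \<Rightarrow> node_tree \<Rightarrow> node_tree \<Rightarrow> bool" where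
  "siblings k s t \<longleftrightarrow> (\<exists>v \<in> nodes s. {(k, TypeA), v} \<in> edges t \<and> {(k, TypeB), v} \<in> edges t)"

lemma UNIV_community: "UNIV = {TypeA, TypeB}"
proof -
  have "c \<in> {TypeA, TypeB}" for c by (cases c) auto
  then show ?thesis by blast
qed

lemma grown_root_tree: "grown 1 root_tree"
  by (auto simp: grown_def root_tree_def UNIV_community)

lemma grown_attach:
  assumes "grown n t" "u \<in> nodes t" "v \<in> nodes t"
  shows "grown (Suc n) (attach (Suc n) u v t)"
  using assms by (auto simp: grown_def attach_def UNIV_community subset_iff) 

text \<open>Old edges avoid the label \<open>Suc n\<close>, so each new node meets an old node
  through its own attachment edge only; a common neighbour must equal both \<open>u\<close> and
  \<open>v\<close>.\<close>

lemma siblings_attach: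
  assumes "grown n t" "u \<in> nodes t" "v \<in> nodes t"
  shows "siblings (Suc n) t (attach (Suc n) u v t) \<longleftrightarrow> u = v"
  using assms by (auto simp: grown_def attach_def siblings_def doubleton_eq_iff subset_iff)

lemma nodes_of_type_grown:
  assumes "grown n t"
  shows "nodes_of_type t c = {1..n} \<times> {c}"
  using assms by (auto simp: grown_def nodes_of_type_def)

lemma grown_step:
  assumes t: "grown n t" and n: "n \<ge> 1" and t': "t' \<in> set_pmf (bcmrt_step q (Suc n) t)"
  shows "grown (Suc n) t'"
proof -
  have fin: "finite (nodes_of_type t c)" "nodes_of_type t c \<noteq> {}" for c
    using n by (auto simp: nodes_of_type_grown[OF t])
  obtain c d u v where "t' = attach (Suc n) u v t"
      "u \<in> nodes_of_type t c" "v \<in> nodes_of_type t d"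
    using t' by (auto simp: bcmrt_step_def set_pmf_of_set[OF fin(2,1)])
  then show ?thesis
    by (auto simp: nodes_of_type_def intro!: grown_attach[OF t])
qed

text \<open>The parents can agree only if their types agree, that is, if exactly one new node
  switches, which has probability \<open>2 * q * (1 - q)\<close>; then they agree with probability
  \<open>1 / n\<close>. The result depends on the tree through \<open>n\<close> alone, which is the
  source of independence between steps.\<close>

lemma map_siblings_step:
  assumes t: "grown n t" and n: "n \<ge> 1" and q: "0 \<le> q" "q \<le> 1"
  shows "map_pmf (siblings (Suc n) t) (bcmrt_step q (Suc n) t) =
    bernoulli_pmf (2 * q * (1 - q) / n)"
proof -
  have fin: "finite (nodes_of_type t c)" "nodes_of_type t c \<noteq> {}" for c
    using n by (auto simp: nodes_of_type_grown[OF t])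
  define K where "K c d = bind_pmf (pmf_of_set (nodes_of_type t c))
    (\<lambda>u. map_pmf (\<lambda>v. u = v) (pmf_of_set (nodes_of_type t d)))" for c d
  have "map_pmf (siblings (Suc n) t) (bcmrt_step q (Suc n) t) =
      do {c \<leftarrow> parent_type_pmf q TypeA; d \<leftarrow> parent_type_pmf q TypeB; K c d}"
    unfolding bcmrt_step_def K_def map_bind_pmf map_return_pmf map_pmf_def[of "(=) _"]
    using fin by (intro bind_pmf_cong refl arg_cong[where f=return_pmf] siblings_attach[OF t])
      (auto simp: nodes_of_type_def)
  also have "\<dots> = bernoulli_pmf (2 * q * (1 - q) / n)"
  proof (rule pmf_bernoulli_eqI)
    have K: "pmf (K c d) True = (if c = d then 1 / n else 0)" for c d
      unfolding K_def coincidence_pmf_of_set[OF fin fin]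
      by (auto simp: nodes_of_type_grown[OF t] card_cartesian_product Times_Int_Times)
    show "pmf (do {c \<leftarrow> parent_type_pmf q TypeA; d \<leftarrow> parent_type_pmf q TypeB; K c d}) True =
        2 * q * (1 - q) / n"
      using q n by (simp add: parent_type_pmf_def pmf_bind K field_simps)
    \<comment> \<open>Expanding the square gives \<open>4 * q * (1 - q) \<le> 1\<close>, more than
      enough here.\<close>
    have "0 \<le> (1 - 2 * q)\<^sup>2" by simp
    then have "2 * q * (1 - q) \<le> 1" by (simp add: power2_eq_square algebra_simps)
    then show "2 * q * (1 - q) / n \<le> 1" using n by (simp add: field_simps)
  qed (use q in simp)
  finally show ?thesis .
qed

section \<open>The law of the whole path\<close>

text \<open>Entry \<open>i\<close> of a path is the tree with time-label \<open>i + 1\<close>; \<open>path_pmf q m\<close> lives on paths of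
  length \<open>m + 1\<close>.\<close>

definition path_pmf :: "real \<Rightarrow> nat \<Rightarrow> node_tree list pmf" where
  "path_pmf q n = rec_nat (return_pmf [root_tree])
     (\<lambda>m P. bind_pmf P (\<lambda>l. map_pmf (\<lambda>t. l @ [t]) (bcmrt_step q (m + 2) (last l)))) n"

lemma path_pmf_0: "path_pmf q 0 = return_pmf [root_tree]"
  and path_pmf_Suc: "path_pmf q (Suc m) =
    bind_pmf (path_pmf q m) (\<lambda>l. map_pmf (\<lambda>t. l @ [t]) (bcmrt_step q (m + 2) (last l)))"
  by (simp_all add: path_pmf_def)

lemma path_pmf_support:
  "l \<in> set_pmf (path_pmf q m) \<Longrightarrow> length l = Suc m \<and> grown (Suc m) (last l)"
proof (induction m arbitrary: l)
  case 0
  then show ?case using grown_root_tree by (simp add: path_pmf_0)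
next
  case (Suc m)
  then obtain l' t where l: "l = l' @ [t]" "l' \<in> set_pmf (path_pmf q m)"
      "t \<in> set_pmf (bcmrt_step q (Suc (Suc m)) (last l'))"
    by (auto simp: path_pmf_Suc)
  then have "grown (Suc (Suc m)) t"
    using Suc.IH by (intro grown_step[OF _ _ l(3)]) auto
  then show ?case using Suc.IH l by simp
qed

text \<open>The extended list determines its prefix, so a single term of the mixture survives. The
  product has the same shape as the locale assumption \<open>transition\<close>.\<close>

lemma pmf_path_snoc:
  "pmf (path_pmf q (Suc m)) (l @ [t]) = pmf (path_pmf q m) l * pmf (bcmrt_step q (m + 2) (last l)) t"
proof -
  have "pmf (map_pmf (\<lambda>t'. l' @ [t']) K) (l @ [t]) = indicator {l} l' * pmf K t" for l' K
  proof -
    have "(\<lambda>t'. l' @ [t']) -` {l @ [t]} = (if l' = l then {t} else {})" by auto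
    then show ?thesis by (simp add: pmf_map measure_pmf_single)
  qed
  then have "pmf (path_pmf q (Suc m)) (l @ [t]) =
      measure_pmf.expectation (path_pmf q m)
        (\<lambda>l'. indicator {l} l' * pmf (bcmrt_step q (m + 2) (last l')) t)"
    by (simp add: path_pmf_Suc pmf_bind)
  also have "\<dots> = measure_pmf.expectation (path_pmf q m)
        (\<lambda>l'. indicator {l} l' * pmf (bcmrt_step q (m + 2) (last l)) t)"
    by (intro Bochner_Integration.integral_cong) (auto simp: indicator_def)
  finally show ?thesis by (simp add: measure_pmf_single)
qed

text \<open>Position \<open>i\<close> holds the tree with label \<open>i + 1\<close>, so the term
  with index \<open>i\<close> concerns the nodes of label \<open>i + 2\<close>.\<close>

definition sibling_count :: "node_tree list \<Rightarrow> nat \<Rightarrow> nat" where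
  "sibling_count l m = (\<Sum>i<m. of_bool (siblings (i + 2) (l ! i) (l ! Suc i)))"

lemma sibling_count_snoc:
  assumes "length l = Suc m"
  shows "sibling_count (l @ [t]) (Suc m) =
    sibling_count l m + of_bool (siblings (m + 2) (last l) t)"
proof -
  have "last l = l ! m" using assms by (cases l rule: rev_cases) auto
  then show ?thesis using assms by (simp add: sibling_count_def nth_append)
qed

text \<open>The law of a sum of independent Bernoulli variables, built recursively to run in
  parallel with \<open>path_pmf\<close>.\<close>

primrec bernoulli_sum_pmf :: "(nat \<Rightarrow> real) \<Rightarrow> nat \<Rightarrow> nat pmf" where
  "bernoulli_sum_pmf p 0 = return_pmf 0"
| "bernoulli_sum_pmf p (Suc m) =
    bind_pmf (bernoulli_sum_pmf p m) (\<lambda>z. map_pmf (\<lambda>b. z + of_bool b) (bernoulli_pmf (p m)))"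

text \<open>By \<open>map_siblings_step\<close> the increment has the same law after every path in
  the support, so the recursion for paths projects to a recursion for counts.\<close>

lemma map_sibling_count_path:
  assumes q: "0 \<le> q" "q \<le> 1"
  shows "map_pmf (\<lambda>l. sibling_count l m) (path_pmf q m) =
    bernoulli_sum_pmf (\<lambda>k. 2 * q * (1 - q) / Suc k) m"
proof (induction m)
  case 0
  then show ?case by (simp add: path_pmf_0 sibling_count_def)
next
  case (Suc m)
  have "map_pmf (\<lambda>l. sibling_count l (Suc m)) (path_pmf q (Suc m)) =
     bind_pmf (path_pmf q m) (\<lambda>l. map_pmf (\<lambda>b. sibling_count l m + of_bool b)
       (map_pmf (siblings (m + 2) (last l)) (bcmrt_step q (m + 2) (last l))))"
    unfolding path_pmf_Suc map_bind_pmf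
    by (intro bind_pmf_cong refl)
      (auto simp: pmf.map_comp o_def sibling_count_snoc path_pmf_support intro!: map_pmf_cong)
  also have "\<dots> = bind_pmf (path_pmf q m) (\<lambda>l. map_pmf (\<lambda>b. sibling_count l m + of_bool b)
       (bernoulli_pmf (2 * q * (1 - q) / Suc m)))"
  proof (intro bind_pmf_cong refl arg_cong[where f = "map_pmf _"])
    fix l assume "l \<in> set_pmf (path_pmf q m)"
    then have "grown (Suc m) (last l)" using path_pmf_support by blast
    from map_siblings_step[OF this _ q]
    show "map_pmf (siblings (m + 2) (last l)) (bcmrt_step q (m + 2) (last l)) =
        bernoulli_pmf (2 * q * (1 - q) / Suc m)" by simp
  qed
  also have "\<dots> = bernoulli_sum_pmf (\<lambda>k. 2 * q * (1 - q) / Suc k) (Suc m)"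
    by (simp add: Suc.IH[symmetric] bind_map_pmf del: of_nat_Suc)
  finally show ?case .
qed

section \<open>Transfer to the given process\<close>

text \<open>Makes the type of nodes countable, so that the existential quantifier over parents in
  \<open>X\<close> is a countable union of events.\<close>

instance community :: countable
  by countable_datatype

context bcmrt
begin

lemma X_measurable [measurable]:
  assumes "k \<ge> 2"
  shows "X T k \<in> borel_measurable M"
proof -
  have *: "{\<omega> \<in> space M. P (T n \<omega>)} \<in> events" if "n \<ge> 1" for n and P :: "node_tree \<Rightarrow> bool"
    using measurable_sets[OF measurable_tree[OF that], of "Collect P"]
    by (simp add: vimage_def Int_def conj_commute)
  have meas: "Measurable.pred M (\<lambda>\<omega>. P (T (k - 1) \<omega>))"
    "Measurable.pred M (\<lambda>\<omega>. P (T k \<omega>))" for P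
    using assms *[of "k - 1" P] *[of k P] by (auto simp: pred_def)
  have "Measurable.pred M (\<lambda>\<omega>. v \<in> nodes (T (k - 1) \<omega>) \<and>
      {(k, TypeA), v} \<in> edges (T k \<omega>) \<and> {(k, TypeB), v} \<in> edges (T k \<omega>))" for v
    by (intro pred_intros_logic meas)
  then have [measurable]: "Measurable.pred M (\<lambda>\<omega>. \<exists>v. v \<in> nodes (T (k - 1) \<omega>) \<and>
      {(k, TypeA), v} \<in> edges (T k \<omega>) \<and> {(k, TypeB), v} \<in> edges (T k \<omega>))"
    by (intro pred_intros_countable)
  then show ?thesis unfolding X_def Bex_def by measurable
qed

lemma Z_measurable [measurable]: "Z T n \<in> borel_measurable M"
  unfolding Z_def by (intro borel_measurable_sum X_measurable) simp

definition path :: "nat \<Rightarrow> 'w \<Rightarrow> node_tree list" where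
  "path m \<omega> = map (\<lambda>k. T (Suc k) \<omega>) [0..<Suc m]"

lemma path_Suc: "path (Suc m) \<omega> = path m \<omega> @ [T (m + 2) \<omega>]"
  by (simp add: path_def)

lemma path_eq_iff:
  assumes "length l = Suc m"
  shows "path m \<omega> = l \<longleftrightarrow> (\<forall>k\<in>{1..Suc m}. T k \<omega> = l ! (k - 1))"
proof -
  have "path m \<omega> = l \<longleftrightarrow> (\<forall>i<Suc m. T (Suc i) \<omega> = l ! i)"
    using assms by (auto simp: path_def list_eq_iff_nth_eq simp del: upt_Suc)
  also have "\<dots> \<longleftrightarrow> (\<forall>k\<in>{1..Suc m}. T k \<omega> = l ! (k - 1))"
    by (auto simp: Ball_def) (metis Suc_le_mono Suc_pred' diff_Suc_1 less_Suc_eq_le le_zero_eq zero_less_Suc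
        Suc_le_eq One_nat_def)
  finally show ?thesis .
qed

text \<open>A single path is a finite intersection of preimages of points. Arbitrary sets of paths
  are not covered, since there are uncountably many trees; this is why \<open>prob_eq_pmf\<close>
  assumes so little.\<close>

lemma path_event: "{\<omega> \<in> space M. path m \<omega> = l} \<in> events"
proof (induction m arbitrary: l)
  case 0
  have eq: "{\<omega> \<in> space M. path 0 \<omega> = l} = T 1 -` {t. [t] = l} \<inter> space M"
    by (auto simp: path_def)
  show ?case unfolding eq by (intro measurable_sets[OF measurable_tree[of 1]]) simp_all
next
  case (Suc m)
  show ?case
  proof (cases l rule: rev_cases)
    case Nil
    then show ?thesis by (simp add: path_Suc)
  next
    case (snoc l' t)
    have "{\<omega> \<in> space M. path (Suc m) \<omega> = l} =
        {\<omega> \<in> space M. path m \<omega> = l'} \<inter> (T (m + 2) -` {t} \<inter> space M)"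
      by (auto simp: path_Suc snoc)
    then show ?thesis using Suc.IH measurable_sets[OF measurable_tree[of "m + 2"]] by simp
  qed
qed

text \<open>\<open>initial\<close> is the base case, and \<open>transition\<close> is the recursion
  of \<open>pmf_path_snoc\<close>.\<close>

lemma prob_path: "length l = Suc m \<Longrightarrow> prob {\<omega> \<in> space M. path m \<omega> = l} = pmf (path_pmf q m) l"
proof (induction m arbitrary: l)
  case 0
  then obtain t where l: "l = [t]" by (auto simp: length_Suc_conv)
  have "prob {\<omega> \<in> space M. path 0 \<omega> = l} = prob {\<omega> \<in> space M. root_tree = t}"
    using initial by (intro finite_measure_eq_AE path_event) (auto simp: path_def l)
  also have "\<dots> = pmf (path_pmf q 0) l"
    by (auto simp: path_pmf_0 l prob_space indicator_def)
  finally show ?case .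
next
  case (Suc m)
  then obtain l' t where l: "l = l' @ [t]" and len: "length l' = Suc m"
    by (cases l rule: rev_cases) auto
  have last: "last l' = l ! m" using len by (cases l' rule: rev_cases) (auto simp: l nth_append)
  have "prob {\<omega> \<in> space M. path (Suc m) \<omega> = l} =
      prob {\<omega> \<in> space M. path m \<omega> = l'} * pmf (bcmrt_step q (m + 2) (last l')) t"
    \<comment> \<open>The tree with label \<open>k\<close> sits at position \<open>k - 1\<close> of
      the list.\<close>
    using transition[of "Suc (Suc m)" "\<lambda>k. l ! (k - 1)"] len
    unfolding path_eq_iff[OF Suc.prems] path_eq_iff[OF len] last
    by (auto simp: l nth_append intro!: arg_cong[where f=prob] arg_cong2[where f="(*)"])
  then show ?case using Suc.IH[OF len] by (simp add: l pmf_path_snoc)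
qed

lemma Z_eq_sibling_count: "Z T (Suc m) \<omega> = sibling_count (path m \<omega>) m"
proof -
  have "Z T (Suc m) \<omega> = (\<Sum>i<m. X T (i + 2) \<omega>)"
    unfolding Z_def
    by (rule sum.reindex_bij_witness[of _ "\<lambda>i. i + 2" "\<lambda>k. k - 2"])
      (auto simp: le_add_diff_inverse2 simp del: add_2_eq_Suc')
  also have "\<dots> = (\<Sum>i<m. of_bool (siblings (i + 2) (path m \<omega> ! i) (path m \<omega> ! Suc i)))"
    by (intro sum.cong) (auto simp: X_def siblings_def path_def simp del: upt_Suc)
  finally show ?thesis by (simp add: sibling_count_def)
qed

lemma distr_Z_Suc:
  "distr M borel (Z T (Suc m)) =
    distr (bernoulli_sum_pmf (\<lambda>k. 2 * q * (1 - q) / Suc k) m) borel real" (is "_ = distr (measure_pmf ?P) _ _")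
proof (rule measure_eqI)
  fix B assume B: "B \<in> sets (distr M borel (Z T (Suc m)))"
  \<comment> \<open>The set of paths is pulled back from \<open>B\<close> through the count, so its
    preimage is an event because \<open>Z\<close> is measurable, as \<open>prob_eq_pmf\<close>
    requires.\<close>
  define A where "A = {l. real (sibling_count l m) \<in> B}"
  have A: "{\<omega> \<in> space M. path m \<omega> \<in> A} = Z T (Suc m) -` B \<inter> space M"
    by (auto simp: A_def Z_eq_sibling_count)
  have "prob {\<omega> \<in> space M. path m \<omega> \<in> A} = measure_pmf.prob (path_pmf q m) A"
  proof (rule prob_eq_pmf)
    show "{\<omega> \<in> space M. path m \<omega> \<in> A} \<in> events"
      unfolding A using B by (intro measurable_sets[OF Z_measurable]) auto
  qed (auto simp: path_event prob_path path_pmf_support)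
  also have "\<dots> = measure_pmf.prob ?P (real -` B)"
    by (simp add: map_sibling_count_path[OF q_range, symmetric] A_def vimage_def del: of_nat_Suc)
  finally show "emeasure (distr M borel (Z T (Suc m))) B = emeasure (distr ?P borel real) B"
    using B by (simp add: emeasure_distr A emeasure_eq_measure measure_pmf.emeasure_eq_measure)
qed simp

end

subsection \<open>The central limit theorem for harmonic Bernoulli sums\<close>

text \<open>Each independent summand multiplies the characteristic function by its own. Finite
  support reduces all expectations to finite sums.\<close>

lemma char_bernoulli_sum:
  assumes p: "\<And>k. 0 \<le> p k" "\<And>k. p k \<le> 1"
  shows "char (distr (bernoulli_sum_pmf p m) borel real) s = (\<Prod>k<m. 1 + complex_of_real (p k) * (iexp s - 1))"
proof -
  have fin: "finite (set_pmf (bernoulli_sum_pmf p m))" for m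
    by (induction m) auto
  have step: "measure_pmf.expectation (bernoulli_pmf (p k)) f = f True * p k + f False * (1 - p k)"
    for f :: "bool \<Rightarrow> complex" and k
    using p by (subst integral_measure_pmf[of UNIV]) (auto simp: UNIV_bool scaleR_conv_of_real)
  have "measure_pmf.expectation (bernoulli_sum_pmf p m) (\<lambda>z. iexp (s * real z)) =
      (\<Prod>k<m. 1 + complex_of_real (p k) * (iexp s - 1))"
  proof (induction m)
    case 0
    then show ?case by simp
  next
    case (Suc m)
    let ?P = "bernoulli_sum_pmf p m"
    have "measure_pmf.expectation (bernoulli_sum_pmf p (Suc m)) (\<lambda>z. iexp (s * real z)) =
        (\<Sum>z\<in>set_pmf ?P. pmf ?P z *\<^sub>R (iexp (s * real (z + 1)) * p m + iexp (s * real z) * (1 - p m)))"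
      unfolding bernoulli_sum_pmf.simps
      using p by (subst pmf_expectation_bind[OF fin[of m]])
        (auto intro!: sum.cong simp: step add.commute)
    also have "\<dots> = (\<Sum>z\<in>set_pmf ?P. pmf ?P z *\<^sub>R iexp (s * real z)) * (1 + complex_of_real (p m) * (iexp s - 1))"
      unfolding sum_distrib_right
      by (intro sum.cong) (auto simp: scaleR_conv_of_real algebra_simps exp_add)
    also have "(\<Sum>z\<in>set_pmf ?P. pmf ?P z *\<^sub>R iexp (s * real z)) =
        measure_pmf.expectation ?P (\<lambda>z. iexp (s * real z))"
      by (rule integral_measure_pmf[symmetric, OF fin]) auto
    finally show ?case using Suc.IH by simp
  qed
  then show ?thesis by (simp add: char_def integral_distr)
qed

section \<open>Comparison with a Poisson characteristic function\<close>

text \<open>A convex combination of 1 and a point of the unit circle. This and the next bound keep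
  all factors in the unit disc, as the telescoping estimate \<open>norm_prod_diff\<close>
  demands.\<close>

lemma norm_convex_iexp_le_1:
  assumes "0 \<le> r" "r \<le> 1"
  shows "norm (1 + complex_of_real r * (iexp s - 1)) \<le> 1"
proof -
  have "1 + complex_of_real r * (iexp s - 1) = of_real (1 - r) + of_real r * iexp s"
    by (simp add: algebra_simps)
  also have "norm \<dots> \<le> norm (complex_of_real (1 - r)) + norm (of_real r * iexp s)"
    by (rule norm_triangle_ineq)
  also have "\<dots> = 1" using assms by (simp add: norm_mult del: of_real_diff)
  finally show ?thesis .
qed

text \<open>The exponent has real part \<open>r * (cos s - 1) \<le> 0\<close>.\<close>

lemma norm_exp_iexp_le_1:
  assumes "0 \<le> r"
  shows "norm (exp (complex_of_real r * (iexp s - 1))) \<le> 1"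
  using assms by (simp add: norm_exp_eq_Re Re_exp mult_nonneg_nonpos)

lemma norm_one_plus_minus_exp_le:
  fixes z :: complex
  assumes "norm z \<le> 2"
  shows "norm (1 + z - exp z) \<le> exp 2 * norm z ^ 2"
proof -
  have "norm (1 + z - exp z) = norm (exp z - (\<Sum>k\<le>1. z ^ k / fact k))"
    by (simp add: norm_minus_commute)
  also have "\<dots> \<le> exp (norm z) * norm z ^ Suc 1 / fact 1"
    by (rule Taylor_exp_field)
  also have "\<dots> \<le> exp 2 * norm z ^ 2"
    using assms by (simp add: numeral_2_eq_2 mult_right_mono)
  finally show ?thesis .
qed

text \<open>Replacing one Bernoulli factor by its Poisson counterpart costs a constant times the
  square of its parameter. The squares \<open>1 / (k + 1)^2\<close> are summable, so
  \<open>C\<close> is uniform in \<open>m\<close> and \<open>s\<close>; the Poisson parameters add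
  up to \<open>a * harm m\<close>.\<close>

lemma bernoulli_sum_poisson_approx:
  assumes a: "0 < a" "a \<le> 1"
  obtains C where "\<And>m s. norm ((\<Prod>k<m. 1 + complex_of_real (a / real (Suc k)) * (iexp s - 1)) -
      exp (complex_of_real (a * harm m) * (iexp s - 1))) \<le> C * norm (iexp s - 1) ^ 2"
proof
  fix m s
  let ?w = "iexp s - 1" and ?p = "\<lambda>k. a / real (Suc k)"
  define S where "S = (\<Sum>k. 1 / real (Suc k) ^ 2)"
  have p: "0 \<le> ?p k" "?p k \<le> 1" for k using a by (auto simp: field_simps)
  have w: "norm ?w \<le> 2" using norm_triangle_ineq4[of "iexp s" 1] by simp
  have "(\<Prod>k<m. exp (complex_of_real (?p k) * ?w)) = exp (complex_of_real (a * harm m) * ?w)"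
    by (simp add: exp_sum[symmetric] sum_distrib_right harm_altdef sum_distrib_left field_simps)
  then have "norm ((\<Prod>k<m. 1 + complex_of_real (?p k) * ?w) - exp (complex_of_real (a * harm m) * ?w))
      \<le> (\<Sum>k<m. norm (1 + complex_of_real (?p k) * ?w - exp (complex_of_real (?p k) * ?w)))"
    using norm_prod_diff[of "{..<m}" "\<lambda>k. 1 + complex_of_real (?p k) * ?w"
        "\<lambda>k. exp (complex_of_real (?p k) * ?w)"] norm_convex_iexp_le_1[OF p] norm_exp_iexp_le_1[OF p(1)]
    by simp
  also have "\<dots> \<le> (\<Sum>k<m. exp 2 * norm ?w ^ 2 * (1 / real (Suc k) ^ 2))"
  proof (rule sum_mono)
    fix k
    have norm: "norm (complex_of_real (?p k) * ?w) = ?p k * norm ?w"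
      using p(1)[of k] by (simp only: norm_mult norm_of_real abs_of_nonneg)
    have "?p k * norm ?w \<le> 1 * 2" by (intro mult_mono p w) auto
    then have "norm (1 + complex_of_real (?p k) * ?w - exp (complex_of_real (?p k) * ?w))
        \<le> exp 2 * norm (complex_of_real (?p k) * ?w) ^ 2"
      by (intro norm_one_plus_minus_exp_le) (simp only: norm)
    also have "\<dots> = exp 2 * norm ?w ^ 2 * (?p k) ^ 2"
      by (simp only: norm power_mult_distrib ac_simps)
    also have "\<dots> \<le> exp 2 * norm ?w ^ 2 * (1 / real (Suc k) ^ 2)"
    proof (rule mult_left_mono)
      have "(?p k) ^ 2 \<le> (1 / real (Suc k)) ^ 2"
        using a by (intro power_mono divide_right_mono) auto
      then show "(?p k) ^ 2 \<le> 1 / real (Suc k) ^ 2" by (simp add: power_divide)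
    qed simp
    finally show "norm (1 + complex_of_real (?p k) * ?w - exp (complex_of_real (?p k) * ?w))
        \<le> exp 2 * norm ?w ^ 2 * (1 / real (Suc k) ^ 2)" .
  qed
  also have "\<dots> \<le> exp 2 * norm ?w ^ 2 * S"
    unfolding sum_distrib_left[symmetric] S_def
    using inverse_squares_sums by (intro mult_left_mono sum_le_suminf) (auto simp: sums_iff add.commute)
  finally show "norm ((\<Prod>k<m. 1 + complex_of_real (?p k) * ?w) -
      exp (complex_of_real (a * harm m) * ?w)) \<le> (exp 2 * (\<Sum>k. 1 / real (Suc k) ^ 2)) * norm ?w ^ 2"
    by (simp add: S_def ac_simps)
qed

text \<open>The logarithm of the characteristic function of a centred and normalised Poisson
  variable with mean \<open>x\<close>. With \<open>u = t / sqrt x\<close>, the real part behaves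
  like \<open>- x * u^2 / 2\<close> and the imaginary part like
  \<open>- x * u^3 / 6\<close>.\<close>

lemma poisson_exponent_limit:
  "((\<lambda>x. complex_of_real x * (iexp (t / sqrt x) - 1) - \<i> * complex_of_real (t * sqrt x))
     \<longlongrightarrow> complex_of_real (- (t\<^sup>2) / 2)) at_top"
proof -
  consider "t = 0" | "t > 0" | "t < 0" by linarith
  then have re: "((\<lambda>x::real. x * (cos (t / sqrt x) - 1)) \<longlongrightarrow> - (t * t / 2)) at_top"
    by cases (simp, real_asymp, real_asymp)
  consider "t = 0" | "t > 0" | "t < 0" by linarith
  then have im: "((\<lambda>x::real. x * sin (t / sqrt x) - t * sqrt x) \<longlongrightarrow> 0) at_top"
    by cases (simp, real_asymp, real_asymp)
  have "((\<lambda>x. Complex (x * (cos (t / sqrt x) - 1)) (x * sin (t / sqrt x) - t * sqrt x))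
      \<longlongrightarrow> Complex (- (t * t / 2)) 0) at_top"
    by (rule tendsto_Complex[OF re im])
  also have "(\<lambda>x. Complex (x * (cos (t / sqrt x) - 1)) (x * sin (t / sqrt x) - t * sqrt x)) =
      (\<lambda>x. complex_of_real x * (iexp (t / sqrt x) - 1) - \<i> * complex_of_real (t * sqrt x))"
    by (intro ext complex_eqI) (simp_all add: Re_exp Im_exp)
  finally show ?thesis by (simp add: complex_of_real_def power2_eq_square)
qed

text \<open>The product is replaced by the Poisson exponential with an error of order
  \<open>norm (iexp (s n) - 1) ^ 2\<close>, which vanishes. The mean \<open>a * harm (n - 1)\<close>
  differs from \<open>a * ln n\<close> by a bounded amount, which is multiplied by a null sequence
  in the exponent.\<close>

lemma bernoulli_sum_clt:
  assumes a: "0 < a" "a \<le> 1"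
  shows "weak_conv_m (\<lambda>n. distr (distr (measure_pmf (bernoulli_sum_pmf (\<lambda>k. a / real (Suc k)) (n - 1))) borel real) borel
      (\<lambda>x. (x - a * ln n) / sqrt (a * ln n))) std_normal_distribution"
proof (rule levy_continuity)
  let ?D = "\<lambda>n::nat. distr (measure_pmf (bernoulli_sum_pmf (\<lambda>k. a / real (Suc k)) (n - 1))) borel real"
  let ?g = "\<lambda>(n::nat) x. (x - a * ln n) / sqrt (a * ln n)"
  show "real_distribution (distr (?D n) borel (?g n))" for n
    by (simp add: distr_distr prob_space.real_distribution_distr[OF measure_pmf.prob_space_axioms])
  show "real_distribution std_normal_distribution" by (rule real_dist_normal_dist)
  fix t :: real
  define x where "x n = a * ln (real n)" for n
  define s where "s n = t / sqrt (x n)" for n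
  define c where "c n = iexp (- (t * sqrt (x n)))" for n
  have x_top: "filterlim x at_top sequentially"
    unfolding x_def using a by real_asymp
  have s0: "s \<longlonglongrightarrow> 0"
    unfolding s_def using x_top
    by (intro tendsto_divide_0[OF tendsto_const] filterlim_at_top_imp_at_infinity
        filterlim_compose[OF sqrt_at_top])
  have w0: "(\<lambda>n. iexp (s n) - 1) \<longlonglongrightarrow> 0"
    by (rule tendsto_eq_intros s0 refl | simp)+
  have p: "0 \<le> a / real (Suc k)" "a / real (Suc k) \<le> 1" for k using a by (auto simp: field_simps)
  have char: "char (distr (?D n) borel (?g n)) t =
      c n * (\<Prod>k<n - 1. 1 + complex_of_real (a / real (Suc k)) * (iexp (s n) - 1))"
    \<comment> \<open>At \<open>n = 1\<close> the variance \<open>a * ln n\<close> is zero and the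
      normalisation degenerates.\<close>
    if "n \<ge> 2" for n
  proof -
    have "x n > 0" using that a by (simp add: x_def)
    then have "t * ((y - x n) / sqrt (x n)) = - (t * sqrt (x n)) + s n * y" for y
      by (simp add: s_def field_simps)
    then have "iexp (t * ((y - x n) / sqrt (x n))) = c n * iexp (s n * y)" for y
      by (simp only: c_def exp_add[symmetric] of_real_add distrib_left)
    then have "char (distr (?D n) borel (?g n)) t = c n * char (?D n) (s n)"
      by (simp add: char_def integral_distr x_def[symmetric] del: of_real_divide of_real_mult)
    then show ?thesis
      by (simp only: char_bernoulli_sum[of "\<lambda>k. a / real (Suc k)", OF p])
  qed
  obtain C where C: "\<And>m s. norm ((\<Prod>k<m. 1 + complex_of_real (a / real (Suc k)) * (iexp s - 1)) -
      exp (complex_of_real (a * harm m) * (iexp s - 1))) \<le> C * norm (iexp s - 1) ^ 2"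
    using bernoulli_sum_poisson_approx[OF a] by blast
  have norm_c: "norm (c n) = 1" for n by (simp add: c_def)
  let ?E = "\<lambda>n. c n * exp (complex_of_real (a * harm (n - 1)) * (iexp (s n) - 1))"
  have diff: "(\<lambda>n. char (distr (?D n) borel (?g n)) t - ?E n) \<longlonglongrightarrow> 0"
  proof (rule Lim_null_comparison)
    show "\<forall>\<^sub>F n in sequentially. norm (char (distr (?D n) borel (?g n)) t - ?E n)
        \<le> C * norm (iexp (s n) - 1) ^ 2"
      using eventually_ge_at_top[of 2]
      by eventually_elim (simp only: char right_diff_distrib[symmetric] norm_mult norm_c mult_1_left C)
    show "(\<lambda>n. C * norm (iexp (s n) - 1) ^ 2) \<longlonglongrightarrow> 0"
      using tendsto_mult[OF tendsto_const[of C] tendsto_power[OF tendsto_norm_zero[OF w0], of 2]]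
      by simp
  qed
  \<comment> \<open>Dropping the last harmonic term \<open>1 / n\<close> does not change the
    Euler-Mascheroni limit.\<close>
  have "(\<lambda>n. harm (n - 1) - ln (real n)) \<longlonglongrightarrow> euler_mascheroni - (0 :: real)"
  proof (rule Lim_transform_eventually)
    show "(\<lambda>n. (harm n - ln (real n)) - 1 / real n) \<longlonglongrightarrow> euler_mascheroni - 0"
      by (intro tendsto_diff euler_mascheroni_LIMSEQ lim_1_over_n)
    show "\<forall>\<^sub>F n in sequentially. (harm n - ln (real n)) - 1 / real n = harm (n - 1) - ln (real n)"
      using eventually_gt_at_top[of 0]
    proof eventually_elim
      case (elim n)
      then show ?case by (cases n) (auto simp: harm_Suc inverse_eq_divide)
    qed
  qed
  then have "(\<lambda>n. complex_of_real (a * (harm (n - 1) - ln (real n))) * (iexp (s n) - 1))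
      \<longlonglongrightarrow> complex_of_real (a * (euler_mascheroni - 0)) * 0"
    by (intro tendsto_mult tendsto_of_real tendsto_const w0)
  from tendsto_add[OF filterlim_compose[OF poisson_exponent_limit[of t] x_top] this]
  have "(\<lambda>n. exp (complex_of_real (x n) * (iexp (s n) - 1) - \<i> * complex_of_real (t * sqrt (x n)) +
      complex_of_real (a * (harm (n - 1) - ln (real n))) * (iexp (s n) - 1)))
      \<longlonglongrightarrow> exp (complex_of_real (- (t\<^sup>2) / 2))"
    unfolding s_def by (intro tendsto_exp) (simp del: of_real_divide of_real_mult of_real_diff)
  \<comment> \<open>The coefficients of \<open>iexp (s n) - 1\<close> combine to
    \<open>a * harm (n - 1)\<close>, and the remaining term is the exponent of
    \<open>c n\<close>.\<close>
  also have "(\<lambda>n. exp (complex_of_real (x n) * (iexp (s n) - 1) - \<i> * complex_of_real (t * sqrt (x n)) +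
      complex_of_real (a * (harm (n - 1) - ln (real n))) * (iexp (s n) - 1))) = ?E"
    unfolding c_def exp_add[symmetric]
    by (intro ext arg_cong[where f=exp]) (simp add: x_def algebra_simps)
  finally have E: "?E \<longlonglongrightarrow> char std_normal_distribution t"
    by (simp only: char_std_normal_distribution exp_of_real)
  show "(\<lambda>n. char (distr (?D n) borel (?g n)) t) \<longlonglongrightarrow> char std_normal_distribution t"
    using tendsto_add[OF diff E] by simp
qed

subsection \<open>Convergence under sequences of maps\<close>

text \<open>Skorohod's coupling turns weak convergence into pointwise convergence, to which
  \<open>lim\<close> applies sample by sample; bounded convergence finishes. Asking for the limit
  along every convergent sequence is what allows the maps to vary with \<open>n\<close>.\<close>

lemma weak_conv_continuous_mapping:
  fixes \<mu> :: "nat \<Rightarrow> real measure" and M :: "real measure"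
    and g :: "nat \<Rightarrow> real \<Rightarrow> real" and g0 :: "real \<Rightarrow> real"
  assumes \<mu>: "\<And>n. real_distribution (\<mu> n)" and M: "real_distribution M"
    and conv: "weak_conv_m \<mu> M"
    and g[measurable]: "\<And>n. g n \<in> borel_measurable borel"
    and g0[measurable]: "g0 \<in> borel_measurable borel"
    and lim: "\<And>s x. s \<longlonglongrightarrow> x \<Longrightarrow> (\<lambda>n. g n (s n)) \<longlonglongrightarrow> g0 x"
  shows "weak_conv_m (\<lambda>n. distr (\<mu> n) borel (g n)) (distr M borel g0)"
proof -
  have sets[measurable_cong]: "sets (\<mu> n) = sets borel" "sets M = sets borel" for n
    using real_distribution.events_eq_borel[OF \<mu>] real_distribution.events_eq_borel[OF M] by auto
  from Skorohod[OF \<mu> M conv] obtain \<Omega> :: "real measure" and Yn Y where \<Omega>: "prob_space \<Omega>"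
    and "\<forall>n. Yn n \<in> borel_measurable \<Omega>" and "\<forall>n. distr \<Omega> borel (Yn n) = \<mu> n"
    and "Y \<in> measurable \<Omega> lborel" and dY: "distr \<Omega> borel Y = M"
    and "\<forall>x\<in>space \<Omega>. (\<lambda>n. Yn n x) \<longlonglongrightarrow> Y x"
    by (elim exE conjE)
  then have Yn[measurable]: "\<And>n. Yn n \<in> borel_measurable \<Omega>" and dYn: "\<And>n. distr \<Omega> borel (Yn n) = \<mu> n"
    and Y[measurable]: "Y \<in> borel_measurable \<Omega>"
    and lY: "\<And>x. x \<in> space \<Omega> \<Longrightarrow> (\<lambda>n. Yn n x) \<longlonglongrightarrow> Y x"
    by simp_all
  interpret \<Omega>: prob_space \<Omega> by fact
  show ?thesis
  proof (rule integral_bdd_continuous_conv_imp_weak_conv)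
    show "real_distribution (distr (\<mu> n) borel (g n))" for n
    proof -
      interpret real_distribution "\<mu> n" by (rule \<mu>)
      show ?thesis by (rule real_distribution_distr) simp
    qed
    show "real_distribution (distr M borel g0)"
    proof -
      interpret real_distribution M by (rule M)
      show ?thesis by (rule real_distribution_distr) simp
    qed
    fix f :: "real \<Rightarrow> real"
    assume f: "\<And>x. isCont f x" and bd: "\<And>x. \<bar>f x\<bar> \<le> 1"
    have [measurable]: "f \<in> borel_measurable borel"
      using f by (auto intro!: borel_measurable_continuous_onI continuous_at_imp_continuous_on)
    have "(\<lambda>n. \<integral>x. f (g n (Yn n x)) \<partial>\<Omega>) \<longlonglongrightarrow> (\<integral>x. f (g0 (Y x)) \<partial>\<Omega>)"
    proof (rule integral_dominated_convergence[where w="\<lambda>_. 1"])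
      show "AE x in \<Omega>. (\<lambda>n. f (g n (Yn n x))) \<longlonglongrightarrow> f (g0 (Y x))"
        using lY lim by (auto intro!: AE_I2 isCont_tendsto_compose[OF f])
    qed (use bd in auto)
    moreover have "(\<integral>x. f (g n (Yn n x)) \<partial>\<Omega>) = integral\<^sup>L (distr (\<mu> n) borel (g n)) f" for n
      by (simp add: integral_distr dYn[symmetric])
    moreover have "(\<integral>x. f (g0 (Y x)) \<partial>\<Omega>) = integral\<^sup>L (distr M borel g0) f"
      by (simp add: integral_distr dY[symmetric])
    ultimately show "(\<lambda>n. integral\<^sup>L (distr (\<mu> n) borel (g n)) f) \<longlonglongrightarrow> integral\<^sup>L (distr M borel g0) f"
      by simp
  qed
qed

text \<open>The Dirac mass at \<open>c\<close> is written as the image of some \<open>N\<close>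
  under a constant map, the form in which the continuous mapping theorem delivers it.\<close>

lemma weak_conv_const_imp_tendsto_in_prob:
  assumes M: "prob_space M" and Y[measurable]: "\<And>n. Y n \<in> borel_measurable M"
    and N: "prob_space N"
    and conv: "weak_conv_m (\<lambda>n. distr M borel (Y n)) (distr N borel (\<lambda>_. c))"
  shows "tendsto_in_prob M Y c"
  unfolding tendsto_in_prob_def
proof (intro allI impI)
  interpret M: prob_space M by fact
  interpret N: prob_space N by fact
  fix \<epsilon> :: real assume \<epsilon>: "\<epsilon> > 0"
  \<comment> \<open>A bounded continuous test function that vanishes at \<open>c\<close> and
    dominates the indicator of a deviation larger than \<open>\<epsilon>\<close>.\<close>
  define f where "f y = min 1 (\<bar>y - c\<bar> / \<epsilon>)" for y
  have [measurable]: "f \<in> borel_measurable borel" unfolding f_def by measurable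
  have bd: "0 \<le> f y" "f y \<le> 1" for y using \<epsilon> by (auto simp: f_def)
  have "(\<lambda>n. integral\<^sup>L (distr M borel (Y n)) f) \<longlonglongrightarrow> integral\<^sup>L (distr N borel (\<lambda>_. c)) f"
  proof (rule weak_conv_imp_integral_bdd_continuous_conv[OF M.real_distribution_distr
        N.real_distribution_distr conv, where B=1])
    show "isCont f x" for x unfolding f_def using \<epsilon> by (intro continuous_intros) auto
  qed (use bd in auto)
  moreover have "integral\<^sup>L (distr N borel (\<lambda>_. c)) f = 0"
    by (subst integral_distr) (simp_all add: f_def)
  ultimately have lim: "(\<lambda>n. \<integral>\<omega>. f (Y n \<omega>) \<partial>M) \<longlonglongrightarrow> 0"
    by (simp add: integral_distr)
  show "(\<lambda>n. measure M {\<omega> \<in> space M. \<bar>Y n \<omega> - c\<bar> > \<epsilon>}) \<longlonglongrightarrow> 0"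
  proof (rule tendsto_sandwich[OF _ _ tendsto_const lim])
    show "\<forall>\<^sub>F n in sequentially. measure M {\<omega> \<in> space M. \<bar>Y n \<omega> - c\<bar> > \<epsilon>} \<le> (\<integral>\<omega>. f (Y n \<omega>) \<partial>M)"
    proof (intro always_eventually allI)
      fix n
      have "measure M {\<omega> \<in> space M. \<bar>Y n \<omega> - c\<bar> > \<epsilon>} =
          (\<integral>\<omega>. indicator {\<omega> \<in> space M. \<bar>Y n \<omega> - c\<bar> > \<epsilon>} \<omega> \<partial>M)" by simp
      also have "\<dots> \<le> (\<integral>\<omega>. f (Y n \<omega>) \<partial>M)"
      proof (rule integral_mono)
        show "integrable M (\<lambda>\<omega>. f (Y n \<omega>))"
          by (rule M.integrable_const_bound[where B=1]) (use bd in auto)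
        show "indicator {\<omega> \<in> space M. \<bar>Y n \<omega> - c\<bar> > \<epsilon>} \<omega> \<le> f (Y n \<omega>)" for \<omega>
        proof (cases "\<bar>Y n \<omega> - c\<bar> > \<epsilon>")
          case True
          then have "f (Y n \<omega>) = 1" using \<epsilon> by (simp add: f_def)
          then show ?thesis by (simp add: indicator_def)
        qed (use bd(1) in simp)
        show "integrable M (indicat_real {\<omega> \<in> space M. \<bar>Y n \<omega> - c\<bar> > \<epsilon>})"
          by (intro integrable_real_indicator) (simp_all add: M.emeasure_eq_measure)
      qed
      finally show "measure M {\<omega> \<in> space M. \<bar>Y n \<omega> - c\<bar> > \<epsilon>} \<le> (\<integral>\<omega>. f (Y n \<omega>) \<partial>M)" .
    qed
  qed simp
qed

lemma weak_conv_m_eventually_cong: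
  assumes "weak_conv_m \<mu> M" and "\<forall>\<^sub>F n in sequentially. \<mu> n = \<nu> n"
  shows "weak_conv_m \<nu> M"
  unfolding weak_conv_m_def weak_conv_def
proof (intro allI impI)
  fix x assume "isCont (cdf M) x"
  then have "(\<lambda>n. cdf (\<mu> n) x) \<longlonglongrightarrow> cdf M x"
    using assms(1) by (simp add: weak_conv_m_def weak_conv_def)
  then show "(\<lambda>n. cdf (\<nu> n) x) \<longlonglongrightarrow> cdf M x"
    by (rule Lim_transform_eventually) (use assms(2) in eventually_elim, simp)
qed

subsection \<open>The estimator\<close>

text \<open>The Gaussian characteristic function is even. This removes the sign that appears in the
  limit for \<open>q = 1/2\<close>.\<close>

lemma distr_uminus_std_normal: "distr std_normal_distribution borel uminus = std_normal_distribution"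
proof (rule Levy_uniqueness)
  interpret real_distribution std_normal_distribution by (rule real_dist_normal_dist)
  show "real_distribution (distr std_normal_distribution borel (uminus :: real \<Rightarrow> real))"
    by (rule real_distribution_distr) simp
  show "real_distribution std_normal_distribution" by (rule real_dist_normal_dist)
  show "char (distr std_normal_distribution borel uminus) = char std_normal_distribution"
  proof
    fix t
    have "char (distr std_normal_distribution borel uminus) t = char std_normal_distribution (- t)"
      unfolding char_def by (subst integral_distr) simp_all
    then show "char (distr std_normal_distribution borel uminus) t = char std_normal_distribution t"
      by (simp add: char_std_normal_distribution)
  qed
qed

lemma phi_measurable [measurable]: "phi \<in> borel_measurable borel"
  unfolding phi_def by measurable

lemma isCont_phi: "isCont phi x"
  unfolding phi_def by (intro continuous_intros) simp

lemma phi_variance: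
  assumes "q \<le> 1/2"
  shows "phi (q * (1 - q)) = q"
proof -
  have "1 - 4 * (q * (1 - q)) = (1 - 2 * q)\<^sup>2" by (simp add: power2_eq_square algebra_simps)
  then have "sqrt (max (1 - 4 * (q * (1 - q))) 0) = 1 - 2 * q" using assms by simp
  then show ?thesis by (simp add: phi_def)
qed

text \<open>Below \<open>1/4\<close> the truncation is inactive, so \<open>phi\<close> agrees there
  with a smooth function; the slope is the reciprocal of the derivative \<open>1 - 2 * q\<close> of
  the inverted map.\<close>

lemma DERIV_phi:
  assumes "q < 1/2"
  shows "DERIV phi (q * (1 - q)) :> 1 / (1 - 2 * q)"
proof (rule has_field_derivative_transform_within_open[where S = "{..<1/4}"])
  have eq: "1 - 4 * (q * (1 - q)) = (1 - 2 * q)\<^sup>2" by (simp add: power2_eq_square algebra_simps)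
  have pos: "(1 - 2 * q)\<^sup>2 > 0" using assms by simp
  have sqrt: "sqrt (1 - 4 * (q * (1 - q))) = 1 - 2 * q" using assms by (simp add: eq)
  have nz: "1 - 2 * q \<noteq> 0" "8 - 16 * q \<noteq> 0" using assms by auto
  have slope: "8 / (8 - 16 * q) = 1 / (1 - 2 * q)"
    unfolding frac_eq_eq[OF nz(2,1)] by simp
  show "((\<lambda>x. (1 - sqrt (1 - 4 * x)) / 2) has_real_derivative 1 / (1 - 2 * q)) (at (q * (1 - q)))"
    using pos unfolding eq[symmetric]
    by (auto intro!: derivative_eq_intros simp: sqrt inverse_eq_divide slope)
  show "q * (1 - q) \<in> {..<1/4}" using pos unfolding eq[symmetric] by simp
qed (auto simp: phi_def)

context bcmrt
begin

lemma distr_Z: "distr M borel (Z T n) =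
    distr (bernoulli_sum_pmf (\<lambda>k. 2 * q * (1 - q) / Suc k) (n - 1)) borel real"
proof (cases n)
  case 0
  \<comment> \<open>Both sums are empty, matching \<open>0 - 1 = 0\<close> on natural
    numbers.\<close>
  have "Z T 0 = Z T (Suc 0)" by (simp add: Z_def fun_eq_iff)
  with distr_Z_Suc[of 0] 0 show ?thesis by simp
qed (simp add: distr_Z_Suc)

lemma q_hat_measurable [measurable]: "q_hat T n \<in> borel_measurable M"
  unfolding q_hat_def[abs_def] by measurable

text \<open>All Bernoulli parameters vanish, so \<open>Z\<close> is almost surely 0, and
  \<open>phi 0 = 0\<close>.\<close>

lemma q_hat_AE_0:
  assumes "q = 0"
  shows "AE \<omega> in M. q_hat T n \<omega> = 0"
proof -
  have "bernoulli_pmf 0 = return_pmf False"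
    by (rule bool_pmf_eqI) simp
  then have "bernoulli_sum_pmf (\<lambda>k. 0) m = return_pmf 0" for m
    by (induction m) (simp_all add: bind_return_pmf)
  then have law: "distr M borel (Z T n) = distr (return_pmf 0) borel real"
    unfolding distr_Z by (simp add: assms)
  have "AE x in distr (measure_pmf (return_pmf 0)) borel real. x = 0"
    by (subst AE_distr_iff) (simp_all add: AE_measure_pmf_iff)
  then have "AE x in distr M borel (Z T n). x = 0" unfolding law .
  then have "AE \<omega> in M. Z T n \<omega> = 0" by (subst (asm) AE_distr_iff) simp_all
  then show ?thesis by eventually_elim (simp add: q_hat_def phi_def)
qed

section \<open>The normalised count and the three limits\<close>

text \<open>As for a Poisson variable, one quantity serves as both mean and variance.\<close>

definition centered_Z :: "nat \<Rightarrow> 'w \<Rightarrow> real" where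
  "centered_Z n \<omega> = (Z T n \<omega> - 2 * q * (1 - q) * ln n) / sqrt (2 * q * (1 - q) * ln n)"

lemma centered_Z_measurable [measurable]: "centered_Z n \<in> borel_measurable M"
  unfolding centered_Z_def[abs_def] by measurable

lemma centered_Z_clt:
  assumes "0 < q" "q < 1"
  shows "weak_conv_m (\<lambda>n. distr M borel (centered_Z n)) std_normal_distribution"
proof -
  let ?a = "2 * q * (1 - q)"
  have "0 \<le> (1 - 2 * q)\<^sup>2" by simp
  then have a: "0 < ?a" "?a \<le> 1" using assms by (simp_all add: power2_eq_square algebra_simps)
  have "distr (distr M borel (Z T n)) borel (\<lambda>x. (x - ?a * ln n) / sqrt (?a * ln n)) =
      distr M borel (centered_Z n)" for n
    by (simp add: distr_distr o_def centered_Z_def[abs_def])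
  with bernoulli_sum_clt[OF a] show ?thesis unfolding distr_Z[symmetric] by simp
qed

text \<open>The common template: \<open>h0\<close> will be constant for consistency, linear for
  \<open>q < 1/2\<close>, and a square root for \<open>q = 1/2\<close>.\<close>

lemma weak_conv_centered_Z:
  assumes q: "0 < q" "q < 1"
    and [measurable]: "\<And>n. h n \<in> borel_measurable borel" "h0 \<in> borel_measurable borel"
    and lim: "\<And>s x. s \<longlonglongrightarrow> x \<Longrightarrow> (\<lambda>n. h n (s n)) \<longlonglongrightarrow> h0 x"
    and F: "\<And>n \<omega>. n \<ge> 2 \<Longrightarrow> F n \<omega> = h n (centered_Z n \<omega>)"
  shows "weak_conv_m (\<lambda>n. distr M borel (F n)) (distr std_normal_distribution borel h0)"
proof (rule weak_conv_m_eventually_cong)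
  show "weak_conv_m (\<lambda>n. distr (distr M borel (centered_Z n)) borel (h n))
      (distr std_normal_distribution borel h0)"
    by (intro weak_conv_continuous_mapping centered_Z_clt q lim real_distribution_distr
        real_dist_normal_dist) simp_all
  show "\<forall>\<^sub>F n in sequentially. distr (distr M borel (centered_Z n)) borel (h n) = distr M borel (F n)"
    using eventually_ge_at_top[of 2]
  proof eventually_elim
    case (elim n)
    then have "F n = h n \<circ> centered_Z n" by (simp add: F fun_eq_iff)
    then show ?case by (simp add: distr_distr)
  qed
qed

text \<open>The reciprocal of the standard deviation of the Poisson approximation after division by
  \<open>2 * ln n\<close>.\<close>

definition scale :: "nat \<Rightarrow> real" where
  "scale n = sqrt (2 * ln (real n) / (q * (1 - q)))"

lemma scale_at_top:
  assumes "0 < q" "q < 1"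
  shows "filterlim scale at_top sequentially"
proof -
  define v where "v = q * (1 - q)"
  have "v > 0" using assms by (simp add: v_def)
  then show ?thesis unfolding scale_def[abs_def] v_def[symmetric] by real_asymp
qed

lemma q_hat_eq:
  assumes "0 < q" "q < 1" "n \<ge> 2"
  shows "q_hat T n \<omega> = phi (q * (1 - q) + centered_Z n \<omega> / scale n)"
proof -
  define v where "v = q * (1 - q)"
  define L where "L = ln (real n)"
  have v: "v > 0" and L: "L > 0" using assms by (simp_all add: v_def L_def)
  \<comment> \<open>The product of the two normalisations is the denominator in the argument of
    \<open>phi\<close>.\<close>
  have "sqrt (2 * v * L) * sqrt (2 * L / v) = sqrt ((2 * L)\<^sup>2)"
    unfolding real_sqrt_mult[symmetric] using v by (simp add: power2_eq_square)
  also have "\<dots> = 2 * L" using L by (intro real_sqrt_unique) simp_all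
  finally have "sqrt (2 * v * L) * sqrt (2 * L / v) = 2 * L" .
  moreover have "centered_Z n \<omega> / scale n = (Z T n \<omega> - 2 * v * L) / (sqrt (2 * v * L) * sqrt (2 * L / v))"
    by (simp add: centered_Z_def scale_def v_def L_def ac_simps)
  ultimately have "v + centered_Z n \<omega> / scale n = Z T n \<omega> / (2 * L)"
    using L by (simp add: field_simps)
  then show ?thesis by (simp add: q_hat_def v_def L_def)
qed

text \<open>For \<open>q > 0\<close> the fluctuation divided by \<open>scale n\<close> vanishes and
  \<open>phi\<close> is continuous. The case \<open>q = 0\<close> is separate because the scale then
  degenerates.\<close>

lemma q_hat_consistent:
  assumes "q \<le> 1/2"
  shows "tendsto_in_prob M (q_hat T) q"
proof (cases "q = 0")
  case True
  have "prob {\<omega> \<in> space M. \<bar>q_hat T n \<omega> - q\<bar> > \<epsilon>} = 0" if "\<epsilon> > 0" for n \<epsilon>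
  proof -
    have "AE \<omega> in M. \<not> \<bar>q_hat T n \<omega> - q\<bar> > \<epsilon>"
      using q_hat_AE_0[OF True, of n] by eventually_elim (use True that in simp)
    then show ?thesis by (intro measure_eq_0_null_sets) (simp add: AE_iff_null)
  qed
  then show ?thesis by (simp add: tendsto_in_prob_def)
next
  case False
  then have q: "0 < q" "q < 1" using q_range assms by auto
  have "weak_conv_m (\<lambda>n. distr M borel (q_hat T n)) (distr std_normal_distribution borel (\<lambda>_. q))"
  proof (rule weak_conv_centered_Z[OF q])
    fix s x assume "s \<longlonglongrightarrow> (x :: real)"
    then have "(\<lambda>n. q * (1 - q) + s n / scale n) \<longlonglongrightarrow> q * (1 - q) + 0"
      using scale_at_top[OF q]
      by (intro tendsto_add tendsto_const real_tendsto_divide_at_top)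
    from isCont_tendsto_compose[OF isCont_phi this]
    show "(\<lambda>n. phi (q * (1 - q) + s n / scale n)) \<longlonglongrightarrow> q"
      using phi_variance[OF assms] by simp
  qed (simp_all add: q_hat_eq[OF q])
  moreover have "prob_space std_normal_distribution"
    using real_dist_normal_dist by (rule real_distribution.axioms)
  ultimately show ?thesis
    by (intro weak_conv_const_imp_tendsto_in_prob prob_space_axioms q_hat_measurable)
qed

text \<open>The delta method at a point where \<open>phi\<close> is differentiable.\<close>

lemma q_hat_clt:
  assumes q: "0 < q" "q < 1/2"
  shows "weak_conv_m
    (\<lambda>n. distr M borel (\<lambda>\<omega>. (2 * ln (real n) / (q * (1 - q))) powr (1/2) * (q_hat T n \<omega> - q)))
    (distr std_normal_distribution borel (\<lambda>x. 1 / (1 - 2 * q) * x))"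
proof -
  have q1: "q < 1" using q by simp
  let ?v = "q * (1 - q)"
  have v: "phi ?v = q" using q by (intro phi_variance) simp
  \<comment> \<open>Caratheodory's form of the derivative avoids dividing by the increment, which
    may be zero.\<close>
  obtain g where g: "\<And>z. phi z - phi ?v = g z * (z - ?v)" "isCont g ?v" "g ?v = 1 / (1 - 2 * q)"
    using DERIV_phi[OF q(2)] unfolding CARAT_DERIV by blast
  show ?thesis
  proof (rule weak_conv_centered_Z[OF q(1) q1])
    show "(\<lambda>x. scale n * (phi (?v + x / scale n) - q)) \<in> borel_measurable borel" for n
      by measurable
    show "(2 * ln (real n) / ?v) powr (1/2) * (q_hat T n \<omega> - q) =
        scale n * (phi (?v + centered_Z n \<omega> / scale n) - q)" if "n \<ge> 2" for n \<omega>
      using that q q1 by (simp add: q_hat_eq scale_def powr_half_sqrt)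
    fix s x assume s: "s \<longlonglongrightarrow> (x :: real)"
    have "(\<lambda>n. ?v + s n / scale n) \<longlonglongrightarrow> ?v + 0"
      using scale_at_top[OF q(1) q1] s
      by (intro tendsto_add tendsto_const real_tendsto_divide_at_top)
    then have "(\<lambda>n. g (?v + s n / scale n)) \<longlonglongrightarrow> 1 / (1 - 2 * q)"
      using isCont_tendsto_compose[OF g(2)] g(3) by simp
    then have "(\<lambda>n. g (?v + s n / scale n) * s n) \<longlonglongrightarrow> 1 / (1 - 2 * q) * x"
      by (intro tendsto_mult s)
    then show "(\<lambda>n. scale n * (phi (?v + s n / scale n) - q)) \<longlonglongrightarrow> 1 / (1 - 2 * q) * x"
    proof (rule Lim_transform_eventually)
      have "\<forall>\<^sub>F n in sequentially. scale n > 0"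
        using scale_at_top[OF q(1) q1] by (simp add: filterlim_at_top_dense)
      then show "\<forall>\<^sub>F n in sequentially. g (?v + s n / scale n) * s n =
          scale n * (phi (?v + s n / scale n) - q)"
        by eventually_elim (use g(1)[unfolded v] in simp)
    qed
  qed simp
qed

text \<open>At the singular point \<open>1/4\<close> the constant term under the root cancels,
  leaving a multiple of the negated fluctuation. The rescaled error is thus one fixed function of
  \<open>centered_Z\<close> for every \<open>n \<ge> 2\<close>.\<close>

lemma q_hat_limit_half:
  assumes q: "q = 1/2"
  shows "weak_conv_m
    (\<lambda>n. distr M borel (\<lambda>\<omega>. (ln (real n) / 2) powr (1/4) * (q_hat T n \<omega> - 1/2)))
    (distr std_normal_distribution borel (\<lambda>x. - (1/2) * sqrt (max x 0)))"
proof -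
  let ?h = "\<lambda>x::real. - (1/2) * sqrt (max x 0)"
  have q': "0 < q" "q < 1" using q by simp_all
  have "weak_conv_m
    (\<lambda>n. distr M borel (\<lambda>\<omega>. (ln (real n) / 2) powr (1/4) * (q_hat T n \<omega> - 1/2)))
    (distr std_normal_distribution borel (\<lambda>x. ?h (- x)))"
  proof (rule weak_conv_centered_Z[OF q', where h = "\<lambda>_ x. ?h (- x)"])
    show "(\<lambda>n. ?h (- s n)) \<longlonglongrightarrow> ?h (- x)" if "s \<longlonglongrightarrow> x" for s x
      using that by (intro tendsto_intros)
    fix n :: nat and \<omega> assume n: "n \<ge> 2"
    let ?x = "centered_Z n \<omega>"
    \<comment> \<open>Here \<open>scale n = 4 * r\<close>, whose 4 cancels the one inside
      \<open>phi\<close>, and \<open>sqrt r\<close> is the fourth root that normalises the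
      statement.\<close>
    define r where "r = sqrt (ln (real n) / 2)"
    have r: "r > 0" using n by (simp add: r_def)
    have "(4::real)\<^sup>2 * (ln (real n) / 2) = 2 * ln (real n) / (q * (1 - q))" by (simp add: q)
    then have "scale n = sqrt (4\<^sup>2 * (ln (real n) / 2))" by (simp add: scale_def)
    also have "\<dots> = 4 * r" unfolding r_def real_sqrt_mult[of "4\<^sup>2"] real_sqrt_abs by simp
    finally have scale: "scale n = 4 * r" .
    have "(ln (real n) / 2) powr (1/4) = (ln (real n) / 2) powr (1/2 * (1/2))" by simp
    also have "\<dots> = sqrt r"
      unfolding powr_powr[symmetric] using n by (simp add: powr_half_sqrt r_def)
    finally have pw: "(ln (real n) / 2) powr (1/4) = sqrt r" .
    have v: "q * (1 - q) = 1/4" by (simp add: q)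
    have "max (1 - 4 * (q * (1 - q) + ?x / scale n)) 0 = max (- ?x) 0 / r"
      unfolding scale v using r by (simp add: max_def field_simps)
    then have "q_hat T n \<omega> - 1/2 = - (1/2) * (sqrt (max (- ?x) 0) / sqrt r)"
      unfolding q_hat_eq[OF q' n] by (simp add: phi_def real_sqrt_divide diff_divide_distrib)
    then show "(ln (real n) / 2) powr (1/4) * (q_hat T n \<omega> - 1/2) = ?h (- ?x)"
      unfolding pw using r by simp
  qed simp_all
  \<comment> \<open>The reflection is moved onto the normal law, where symmetry absorbs it.\<close>
  also have "distr std_normal_distribution borel (\<lambda>x. ?h (- x)) =
      distr (distr std_normal_distribution borel uminus) borel ?h"
    by (subst distr_distr) (simp_all add: o_def)
  finally show ?thesis unfolding distr_uminus_std_normal .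
qed

end

theorem theorem3:
  fixes M :: "'w measure" and q :: real and T :: "nat \<Rightarrow> 'w \<Rightarrow> node_tree"
  assumes "0 \<le> q" and "q \<le> 1/2" and "bcmrt M q T"
  shows "tendsto_in_prob M (q_hat T) q \<and>
    (q = 0 \<longrightarrow> (\<forall>n\<ge>2. AE \<omega> in M. q_hat T n \<omega> = 0)) \<and>
    (0 < q \<and> q < 1/2 \<longrightarrow>
      weak_conv_m
        (\<lambda>n. distr M borel (\<lambda>\<omega>. (2 * ln (real n) / (q * (1 - q))) powr (1/2) * (q_hat T n \<omega> - q)))
        (distr std_normal_distribution borel (\<lambda>x. 1 / (1 - 2 * q) * x))) \<and>
    (q = 1/2 \<longrightarrow>
      weak_conv_m
        (\<lambda>n. distr M borel (\<lambda>\<omega>. (ln (real n) / 2) powr (1/4) * (q_hat T n \<omega> - 1/2)))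
        (distr std_normal_distribution borel (\<lambda>x. - (1/2) * sqrt (max x 0))))"
proof -
  interpret bcmrt M q T by fact
  show ?thesis
    using q_hat_consistent[OF assms(2)] q_hat_AE_0 q_hat_clt q_hat_limit_half by blast
qed

end
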